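(* Let $P(z),Q(z)\in\mathbb{C}[z]$, $\deg P=n$, $\deg Q=m$. Let $U\subset\mathbb{C}$ be a simply connected domain containing no critical values of $P$, let $P_1^{-1}(z),\dots,P_n^{-1}(z)$ be the single-valued branches of $P^{-1}(z)$ in $U$, and let $$\psi(z)=\sum_{i=1}^n f_i\,Q(P_i^{-1}(z)),\qquad f_i\in\mathbb{C}.$$ Let $z_0\in U$. To verify that $\psi(z)\equiv 0$ it is enough to check that the first $\left(\frac{m}{n}\right)^{n!}+1$ coefficients of the series $\psi(z)=\sum_{k=0}^\infty v_k(z-z_0)^k$ vanish.
   Context: Here $P^{-1}(z)$ denotes the algebraic function inverse to $P(z)$, and the series is the Taylor expansion of $\psi$ at $z_0$.
   Formalization: The printed number (m/n)^{n!}+1 of coefficients is replaced by (m/n)·n!+1, since the printed one is too small: for P=z²+z, Q=z², z_0=0, ψ=(P_1^{-1})² with P_1^{-1}(0)=0, the first 2 coefficients vanish but ψ=z²+… is not zero. *)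

theory Defs
  imports "HOL-Complex_Analysis.Complex_Analysis"
begin

definition critical_values :: "complex poly \<Rightarrow> complex set" where
  "critical_values P = poly P ` {c. poly (pderiv P) c = 0}"

definition inverse_branch :: "complex poly \<Rightarrow> complex set \<Rightarrow> (complex \<Rightarrow> complex) \<Rightarrow> bool" where
  "inverse_branch P U g \<longleftrightarrow> g holomorphic_on U \<and> (\<forall>z\<in>U. poly P (g z) = z)"

(* On a connected open set there are at most degree P branches, so degree P pairwise
   different ones exhaust them: g 1, ..., g (degree P) lists each branch exactly once.
   Functions are total in HOL, so being different has to be read on U. *)
definition inverse_branches ::
    "complex poly \<Rightarrow> complex set \<Rightarrow> (nat \<Rightarrow> complex \<Rightarrow> complex) \<Rightarrow> bool" where
  "inverse_branches P U g \<longleftrightarrow>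
     (\<forall>i\<in>{1..degree P}. inverse_branch P U (g i)) \<and>
     (\<forall>i\<in>{1..degree P}. \<forall>j\<in>{1..degree P}. i \<noteq> j \<longrightarrow> (\<exists>z\<in>U. g i z \<noteq> g j z))"

(* Number of Taylor coefficients to check.  The source prints (m/n)^(n!) + 1; the
   theorem is stated with (m/n) * n! + 1, which equals m * (n - 1)! + 1 for n > 0, because
   the printed number is too small: for P = x^2 + x, Q = x^2 (so n = m = 2) and the branch g
   of the inverse of P with g 0 = 0, the function g^2 has the expansion z^2 + ... at 0, so
   that its first 1^2 + 1 = 2 coefficients vanish.  (m/n) * n! bounds the degree of the
   product of the at most n! conjugates of psi over C(z), since each of them is
   O(|z|^(m/n)) at infinity. *)

end

theory Submission
  imports Defs "HOL-Computational_Algebra.Fundamental_Theorem_Algebra"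
begin

text \<open>
  Permuting the branches turns \<open>\<psi>\<close> into conjugates \<open>\<psi>\<^sub>\<sigma> = \<Sum>i. f i * Q \<circ> g (\<sigma> i)\<close>, one for each
  permutation \<open>\<sigma>\<close> of the indices. The coefficients of the resolvent \<open>\<Prod>\<sigma>. (T - \<psi>\<^sub>\<sigma>)\<close> do not depend on
  the numbering of the branches, so they are single-valued and holomorphic off the critical values
  of \<open>P\<close>. Since \<open>\<psi>\<^sub>\<sigma> = O(|z|\<^bsup>m/n\<^esup>)\<close>, removing the singularities and Liouville's theorem make them
  polynomials in \<open>z\<close> of degree at most \<open>D = (m/n) n!\<close>. Some conjugates may vanish identically without
  \<open>\<psi>\<close> doing so; if there are \<open>a\<close> of them, the coefficient of \<open>T\<^sup>a\<close> is, up to sign, the product of the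
  others. If \<open>\<psi>\<close> is not identically zero, it is one of these factors, so \<open>\<psi>\<close> vanishing to order
  greater than \<open>D\<close> at \<open>z0\<close> would make this polynomial zero, and hence one of the factors.
\<close>

section \<open>Branches of the inverse of a polynomial\<close>

text \<open>For constant \<open>P\<close> every point is critical, but they all share one
  value.\<close>

lemma finite_critical_values: "finite (critical_values P)"
proof (cases "pderiv P = 0")
  case True
  then obtain c where "P = [:c:]"
    using pderiv_iszero by blast
  then show ?thesis
    by (auto simp: critical_values_def intro: finite_subset[of _ "{c}"])
next
  case False
  then show ?thesis
    by (simp add: critical_values_def poly_roots_finite)
qed

text \<open>A double root of P - z would be a critical point with value z. So P - z is squarefree
  and splits into distinct linear factors.\<close>

lemma card_fiber_noncritical:
  assumes "z \<notin> critical_values P"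
  shows "card {w. poly P w = z} = degree P"
proof -
  define p where "p = P - [:z:]"
  have fiber: "{w. poly P w = z} = {w. poly p w = 0}"
    by (auto simp: p_def)
  have "degree p = degree P"
  proof (cases "degree P = 0")
    case True
    then show ?thesis
      unfolding p_def by (metis degree_diff_le degree_pCons_0 le_zero_eq order_refl)
  next
    case False
    then show ?thesis
      unfolding p_def
      by (metis degree_add_eq_left degree_minus degree_pCons_0 diff_conv_add_uminus gr0I)
  qed
  have "rsquarefree p"
    using assms by (auto simp: rsquarefree_roots critical_values_def p_def pderiv_diff pderiv_pCons)
  then have "p \<noteq> 0"
    by (simp add: rsquarefree_def)
  have "degree p = degree (smult (lead_coeff p) (\<Prod>w | poly p w = 0. [:-w, 1:]))"
    using complex_poly_decompose_rsquarefree[OF \<open>rsquarefree p\<close>] by simp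
  also have "\<dots> = card {w. poly p w = 0}"
    using \<open>p \<noteq> 0\<close> by (simp add: degree_prod_sum_eq)
  finally show ?thesis
    using fiber \<open>degree p = degree P\<close> by simp
qed

lemma deriv_poly: "deriv (poly P) w = poly (pderiv P) w"
  for P :: "complex poly"
  by (rule DERIV_imp_deriv) (rule poly_DERIV)

text \<open>A nonzero derivative makes \<open>P\<close> injective near w with open image, and the
  inverse of an injective holomorphic map is holomorphic.\<close>

lemma local_inverse_branch:
  assumes "poly (pderiv P) w \<noteq> 0"
  obtains s h where "s > 0" "inverse_branch P (ball (poly P w) s) h" "h (poly P w) = w"
proof -
  have hol: "poly P holomorphic_on A" for A
    using poly_holomorphic_on[of "\<lambda>z. z" A P] by simp
  obtain r where r: "r > 0" "open (poly P ` ball w r)" "inj_on (poly P) (ball w r)"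
    using has_complex_derivative_locally_invertible[OF hol, of w UNIV] assms
    by (auto simp: deriv_poly)
  obtain h where h: "h holomorphic_on (poly P ` ball w r)"
      "\<And>x. x \<in> ball w r \<Longrightarrow> h (poly P x) = x"
    using holomorphic_has_inverse[OF hol open_ball r(3)] by metis
  obtain s where s: "s > 0" "ball (poly P w) s \<subseteq> poly P ` ball w r"
    using r open_contains_ball[of "poly P ` ball w r"] by force
  show ?thesis
  proof
    show "s > 0" "h (poly P w) = w"
      using s h r by auto
    show "inverse_branch P (ball (poly P w) s) h"
      unfolding inverse_branch_def
    proof (intro conjI ballI)
      show "h holomorphic_on ball (poly P w) s"
        using h(1) s(2) by (rule holomorphic_on_subset)
      fix z assume "z \<in> ball (poly P w) s"
      then obtain x where "x \<in> ball w r" "z = poly P x"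
        using s(2) by blast
      then show "poly P (h z) = z"
        using h(2) by simp
    qed
  qed
qed

text \<open>Two branches that meet at a point agree near it, since \<open>P\<close> is injective near its value;
  hence they agree everywhere.\<close>

lemma inverse_branch_unique:
  assumes U: "open U" "connected U" and crit: "U \<inter> critical_values P = {}"
    and g: "inverse_branch P U g" and h: "inverse_branch P U h"
    and a: "a \<in> U" "g a = h a" and z: "z \<in> U"
  shows "g z = h z"
proof -
  have gh: "g holomorphic_on U" "h holomorphic_on U"
      "\<And>z. z \<in> U \<Longrightarrow> poly P (g z) = z" "\<And>z. z \<in> U \<Longrightarrow> poly P (h z) = z"
    using g h by (auto simp: inverse_branch_def)
  have "poly P (g a) = a"
    using gh a by auto
  then have "poly (pderiv P) (g a) \<noteq> 0"
    using crit a unfolding critical_values_def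
    by (metis (mono_tags, lifting) disjoint_iff image_eqI mem_Collect_eq)
  then obtain r where r: "r > 0" "inj_on (poly P) (ball (g a) r)"
    using has_complex_derivative_locally_injective[of "poly P" UNIV "g a"]
      poly_holomorphic_on[of "\<lambda>z. z" UNIV P] by (auto simp: deriv_poly)
  define V where "V = (U \<inter> g -` ball (g a) r) \<inter> (U \<inter> h -` ball (g a) r)"
  have "open V"
    unfolding V_def using gh U
    by (intro open_Int continuous_open_preimage holomorphic_on_imp_continuous_on) auto
  moreover have "a \<in> V" "V \<subseteq> U"
    using a r by (auto simp: V_def)
  moreover have "g x = h x" if "x \<in> V" for x
    using that r(2) gh by (auto simp: V_def inj_on_def)
  ultimately show ?thesis
    using analytic_continuation_open[of V U g h z] U gh z by auto
qed

text \<open>Different branches never meet, so at z they take \<open>degree P\<close> distinct values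
  in a fiber with exactly that many points.\<close>

lemma inverse_branches_bij_betw:
  assumes U: "open U" "connected U" and crit: "U \<inter> critical_values P = {}"
    and g: "inverse_branches P U g" and z: "z \<in> U"
  shows "bij_betw (\<lambda>i. g i z) {1..degree P} {w. poly P w = z}"
proof -
  have inj: "inj_on (\<lambda>i. g i z) {1..degree P}"
  proof (rule inj_onI, rule ccontr)
    fix i j assume ij: "i \<in> {1..degree P}" "j \<in> {1..degree P}" "g i z = g j z" "i \<noteq> j"
    then have "\<forall>x\<in>U. g i x = g j x"
      using inverse_branch_unique[OF U crit, of "g i" "g j" z] g z
      by (auto simp: inverse_branches_def)
    then show False
      using g ij unfolding inverse_branches_def by blast
  qed
  have card: "card {w. poly P w = z} = degree P"
    using crit z by (intro card_fiber_noncritical) auto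
  have "(\<lambda>i. g i z) ` {1..degree P} \<subseteq> {w. poly P w = z}"
    using g z by (auto simp: inverse_branches_def inverse_branch_def)
  \<comment> \<open>An infinite set has \<open>card\<close> 0, so the cardinality proves finiteness
    only for positive degree. For constant \<open>P\<close> the fiber is empty.\<close>
  moreover have "finite {w. poly P w = z}"
  proof (cases "degree P = 0")
    case True
    then obtain c where "P = [:c:]"
      using degree_eq_zeroE by blast
    then show ?thesis
      using crit z by (auto simp: critical_values_def)
  next
    case False
    then show ?thesis
      using card by (metis card.infinite)
  qed
  ultimately have "(\<lambda>i. g i z) ` {1..degree P} = {w. poly P w = z}"
    using card card_image[OF inj] by (intro card_subset_eq) auto
  with inj show ?thesis
    by (simp add: bij_betw_def)
qed

text \<open>Take a local inverse through each point of the fiber over z and shrink them all to a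
  common disc; they already differ at its centre.\<close>

lemma local_inverse_branches:
  assumes "z \<notin> critical_values P"
  obtains r h where "r > 0" "ball z r \<inter> critical_values P = {}" "inverse_branches P (ball z r) h"
proof (cases "degree P = 0")
  case True
  obtain r where "r > 0" "ball z r \<subseteq> - critical_values P"
    using assms finite_critical_values[of P]
    by (metis ComplI finite_imp_closed open_Compl open_contains_ball_eq)
  with True that[of r] show ?thesis
    by (auto simp: inverse_branches_def)
next
  case False
  have card: "card {w. poly P w = z} = degree P"
    using assms by (rule card_fiber_noncritical)
  then have fin: "finite {w. poly P w = z}"
    using False by (metis card.infinite)
  obtain e where e: "bij_betw e {1..degree P} {w. poly P w = z}"
    using ex_bij_betw_nat_finite_1[OF fin] card by auto
  have "\<exists>s h. s > 0 \<and> inverse_branch P (ball z s) h \<and> h z = e i" if "i \<in> {1..degree P}" for i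
  proof -
    have "poly P (e i) = z"
      using e that by (auto simp: bij_betw_def)
    moreover from this have "poly (pderiv P) (e i) \<noteq> 0"
      using assms by (auto simp: critical_values_def)
    ultimately show ?thesis
      by (metis local_inverse_branch)
  qed
  then obtain s h where sh: "\<And>i. i \<in> {1..degree P} \<Longrightarrow>
      s i > 0 \<and> inverse_branch P (ball z (s i)) (h i) \<and> h i z = e i"
    by metis
  obtain r0 where r0: "r0 > 0" "ball z r0 \<subseteq> - critical_values P"
    using assms finite_critical_values[of P]
    by (metis ComplI finite_imp_closed open_Compl open_contains_ball_eq)
  define r where "r = Min (insert r0 (s ` {1..degree P}))"
  have r: "r > 0" "r \<le> r0"
    using r0 sh by (auto simp: r_def)
  have r_le: "r \<le> s i" if "i \<in> {1..degree P}" for i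
    unfolding r_def using that by (intro Min_le) auto
  show ?thesis
  proof
    show "r > 0"
      by fact
    show "ball z r \<inter> critical_values P = {}"
      using r0 r by force
    show "inverse_branches P (ball z r) h"
      unfolding inverse_branches_def
    proof (intro conjI ballI impI)
      fix i assume i: "i \<in> {1..degree P}"
      show "inverse_branch P (ball z r) (h i)"
        using sh[OF i] subset_ball[OF r_le[OF i], of z]
        by (auto simp: inverse_branch_def intro: holomorphic_on_subset)
      fix j assume j: "j \<in> {1..degree P}" "i \<noteq> j"
      then have "e i \<noteq> e j"
        using i e by (metis bij_betw_def inj_onD)
      then have "h i z \<noteq> h j z"
        using sh[OF i] sh[OF j(1)] by simp
      then show "\<exists>y\<in>ball z r. h i y \<noteq> h j y"
        using \<open>r > 0\<close> by (intro bexI[of _ z]) auto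
    qed
  qed
qed

section \<open>The resolvent\<close>

text \<open>Here \<open>v\<close> numbers the points of one fiber of \<open>P\<close>, so this is
  the value of the conjugate \<psi>_\<sigma> at a single point.\<close>

definition permuted_sum ::
    "complex poly \<Rightarrow> nat \<Rightarrow> (nat \<Rightarrow> complex) \<Rightarrow> (nat \<Rightarrow> complex) \<Rightarrow> (nat \<Rightarrow> nat) \<Rightarrow> complex" where
  "permuted_sum Q n f v \<sigma> = (\<Sum>i=1..n. f i * poly Q (v (\<sigma> i)))"

text \<open>The product runs over the whole symmetric group, with equal conjugates repeated, so that
  renumbering the fiber only reorders its factors.\<close>

definition resolvent ::
    "complex poly \<Rightarrow> nat \<Rightarrow> (nat \<Rightarrow> complex) \<Rightarrow> (nat \<Rightarrow> complex) \<Rightarrow> complex poly" where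
  "resolvent Q n f v = (\<Prod>\<sigma> | \<sigma> permutes {1..n}. [:- permuted_sum Q n f v \<sigma>, 1:])"

lemma permuted_sum_compose:
  assumes "\<And>i. i \<in> {1..n} \<Longrightarrow> v' i = v (\<tau> i)" and "\<sigma> permutes {1..n}"
  shows "permuted_sum Q n f v' \<sigma> = permuted_sum Q n f v (\<tau> \<circ> \<sigma>)"
  unfolding permuted_sum_def
proof (rule sum.cong)
  fix i assume "i \<in> {1..n}"
  then have "\<sigma> i \<in> {1..n}"
    using permutes_in_image[OF assms(2)] by blast
  then show "f i * poly Q (v' (\<sigma> i)) = f i * poly Q (v ((\<tau> \<circ> \<sigma>) i))"
    using assms(1) by simp
qed simp

text \<open>Two numberings of the same set differ by a permutation \<open>\<tau>\<close>, and
  composing with \<open>\<tau>\<close> on the left is a bijection of the symmetric group.\<close>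

lemma resolvent_cong:
  assumes v: "bij_betw v {1..n} A" and v': "bij_betw v' {1..n} A"
  shows "resolvent Q n f v' = resolvent Q n f v"
proof -
  \<comment> \<open>Outside \<open>{1..n}\<close> the identity is forced by
    \<open>permutes\<close>.\<close>
  define \<tau> where "\<tau> i = (if i \<in> {1..n} then inv_into {1..n} v (v' i) else i)" for i
  have "bij_betw (inv_into {1..n} v \<circ> v') {1..n} {1..n}"
    using v v' by (intro bij_betw_trans[OF v'] bij_betw_inv_into)
  then have "bij_betw \<tau> {1..n} {1..n}"
    by (rule bij_betw_cong[THEN iffD1, rotated]) (auto simp: \<tau>_def)
  then have \<tau>: "\<tau> permutes {1..n}"
    by (rule bij_imp_permutes) (auto simp: \<tau>_def)
  have v\<tau>: "v' i = v (\<tau> i)" if "i \<in> {1..n}" for i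
    using that v v' by (simp add: \<tau>_def bij_betw_inv_into_right bij_betwE)
  have eq: "permuted_sum Q n f v' \<sigma> = permuted_sum Q n f v (\<tau> \<circ> \<sigma>)"
    if "\<sigma> permutes {1..n}" for \<sigma>
    using v\<tau> that by (rule permuted_sum_compose)
  have bij: "bij_betw ((\<circ>) \<tau>) {\<sigma>. \<sigma> permutes {1..n}} {\<sigma>. \<sigma> permutes {1..n}}"
  proof (rule bij_betw_byWitness[where f' = "(\<circ>) (inv \<tau>)"])
    show "\<forall>\<sigma>\<in>{\<sigma>. \<sigma> permutes {1..n}}. inv \<tau> \<circ> (\<tau> \<circ> \<sigma>) = \<sigma>"
      using permutes_inv_o(2)[OF \<tau>] by (simp add: o_assoc)
    show "\<forall>\<sigma>\<in>{\<sigma>. \<sigma> permutes {1..n}}. \<tau> \<circ> (inv \<tau> \<circ> \<sigma>) = \<sigma>"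
      using permutes_inv_o(1)[OF \<tau>] by (simp add: o_assoc)
  qed (use \<tau> in \<open>auto intro: permutes_compose permutes_inv\<close>)
  have "resolvent Q n f v' = (\<Prod>\<sigma> | \<sigma> permutes {1..n}. [:- permuted_sum Q n f v (\<tau> \<circ> \<sigma>), 1:])"
    unfolding resolvent_def by (intro prod.cong refl) (simp add: eq del: One_nat_def)
  also have "\<dots> = resolvent Q n f v"
    unfolding resolvent_def by (rule prod.reindex_bij_betw[OF bij])
  finally show ?thesis .
qed

section \<open>Coefficients of products of monic linear factors\<close>

lemma coeff_linear_mult:
  "coeff ([:- c, 1:] * p) k = (if k = 0 then 0 else coeff p (k - 1)) - c * coeff p k"
  for c :: "'a::comm_ring_1"
  by (cases k) (auto simp: algebra_simps)

lemma coeff_prod_linear_holomorphic: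
  assumes "finite A" and "\<And>x. x \<in> A \<Longrightarrow> c x holomorphic_on U"
  shows "(\<lambda>z. coeff (\<Prod>x\<in>A. [:- c x z, 1:]) k) holomorphic_on U"
  using assms
proof (induction A arbitrary: k rule: finite_induct)
  case empty
  then show ?case
    by simp
next
  case (insert x A)
  have "(\<lambda>z. (if k = 0 then 0 else coeff (\<Prod>x\<in>A. [:- c x z, 1:]) (k - 1))
          - c x z * coeff (\<Prod>x\<in>A. [:- c x z, 1:]) k) holomorphic_on U"
    using insert by (cases "k = 0") (auto intro!: holomorphic_intros)
  then show ?case
    unfolding prod.insert[OF insert.hyps] coeff_linear_mult .
qed

text \<open>Multiplying by one more factor turns a bound M for all coefficients into M + B
  M.\<close>

lemma norm_coeff_prod_linear_le:
  fixes c :: "'b \<Rightarrow> 'a::{real_normed_algebra_1,comm_ring_1}"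
  assumes "finite A" and "\<And>x. x \<in> A \<Longrightarrow> norm (c x) \<le> B" and "B \<ge> 0"
  shows "norm (coeff (\<Prod>x\<in>A. [:- c x, 1:]) k) \<le> (1 + B) ^ card A"
  using assms
proof (induction A arbitrary: k rule: finite_induct)
  case empty
  then show ?case
    by (simp add: one_pCons coeff_pCons split: nat.split)
next
  case (insert x A)
  let ?p = "\<Prod>x\<in>A. [:- c x, 1:]"
  have IH: "norm (coeff ?p k) \<le> (1 + B) ^ card A" for k
    using insert by simp
  have "norm (coeff ([:- c x, 1:] * ?p) k)
      \<le> norm (if k = 0 then 0 else coeff ?p (k - 1)) + norm (c x * coeff ?p k)"
    unfolding coeff_linear_mult by (rule norm_triangle_ineq4)
  also have "norm (if k = 0 then 0 else coeff ?p (k - 1)) \<le> (1 + B) ^ card A"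
    using IH \<open>B \<ge> 0\<close> by simp
  also have "norm (c x * coeff ?p k) \<le> norm (c x) * norm (coeff ?p k)"
    by (rule norm_mult_ineq)
  also have "\<dots> \<le> B * (1 + B) ^ card A"
    using insert.prems IH by (intro mult_mono) auto
  finally show ?case
    using insert.hyps by (simp add: algebra_simps)
qed

text \<open>Each index in \<open>Z\<close> contributes a factor T, so this is the constant
  coefficient of the product of the remaining factors.\<close>

lemma coeff_prod_linear_card_zeros:
  fixes c :: "'b \<Rightarrow> 'a::idom"
  assumes "finite A" and "Z \<subseteq> A" and "\<And>x. x \<in> Z \<Longrightarrow> c x = 0"
  shows "coeff (\<Prod>x\<in>A. [:- c x, 1:]) (card Z) = (\<Prod>x\<in>A - Z. - c x)"
proof -
  have "(\<Prod>x\<in>A. [:- c x, 1:]) = (\<Prod>x\<in>A - Z. [:- c x, 1:]) * (\<Prod>x\<in>Z. [:- c x, 1:])"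
    using assms by (intro prod.subset_diff) auto
  also have "(\<Prod>x\<in>Z. [:- c x, 1:]) = (\<Prod>x\<in>Z. [:0, 1:])"
    using assms by (intro prod.cong) auto
  also have "\<dots> = monom 1 (card Z)"
    by (simp add: monom_altdef)
  finally have "(\<Prod>x\<in>A. [:- c x, 1:]) = monom 1 (card Z) * (\<Prod>x\<in>A - Z. [:- c x, 1:])"
    by (simp only: mult.commute)
  then have "coeff (\<Prod>x\<in>A. [:- c x, 1:]) (card Z) = coeff (\<Prod>x\<in>A - Z. [:- c x, 1:]) 0"
    by (simp add: coeff_monom_mult)
  then show ?thesis
    by (simp add: poly_0_coeff_0[symmetric] poly_prod)
qed

section \<open>Growth of polynomials\<close>

text \<open>With \<open>max 1 (norm w)\<close> as base, the power \<open>d\<close> dominates all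
  lower ones for every w, not only for large w.\<close>

lemma norm_poly_le_max_power:
  fixes p :: "'a::real_normed_field poly"
  assumes "degree p \<le> d"
  shows "norm (poly p w) \<le> (\<Sum>i\<le>d. norm (coeff p i)) * max 1 (norm w) ^ d"
proof -
  have "norm (poly p w) \<le> (\<Sum>i\<le>degree p. norm (coeff p i * w ^ i))"
    unfolding poly_altdef by (rule norm_sum)
  also have "\<dots> \<le> (\<Sum>i\<le>d. norm (coeff p i * w ^ i))"
    using assms by (intro sum_mono2) auto
  also have "\<dots> \<le> (\<Sum>i\<le>d. norm (coeff p i) * max 1 (norm w) ^ d)"
  proof (rule sum_mono)
    fix i assume "i \<in> {..d}"
    have "norm w ^ i \<le> max 1 (norm w) ^ i"
      by (intro power_mono) auto
    also have "\<dots> \<le> max 1 (norm w) ^ d"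
      using \<open>i \<in> {..d}\<close> by (intro power_increasing) auto
    finally show "norm (coeff p i * w ^ i) \<le> norm (coeff p i) * max 1 (norm w) ^ d"
      by (simp add: norm_mult norm_power mult_left_mono)
  qed
  finally show ?thesis
    by (simp add: sum_distrib_right)
qed

text \<open>Far out, the lower terms are at most half the leading term, which is then at most twice
  the norm of the value; elsewhere the left side is bounded.\<close>

lemma max_power_le_norm_poly:
  fixes p :: "'a::real_normed_field poly"
  assumes "degree p > 0"
  obtains C where "C \<ge> 1" "\<And>w. max 1 (norm w) ^ degree p \<le> C * max 1 (norm (poly p w))"
proof -
  obtain d where d: "degree p = Suc d"
    using assms gr0_conv_Suc by blast
  define q where "q = p - monom (lead_coeff p) (degree p)"
  define S where "S = (\<Sum>i\<le>d. norm (coeff q i))"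
  define a where "a = norm (lead_coeff p)"
  \<comment> \<open>One summand for each case below: \<open>norm w\<close> at most 1, w in the disc
    where the leading term need not dominate, and w beyond it.\<close>
  define C where "C = 1 + (2 * S / a) ^ degree p + 2 / a"
  have "a > 0" "S \<ge> 0"
    using assms by (auto simp: a_def S_def intro: sum_nonneg)
  have "degree q \<le> d"
  proof (rule degree_le, intro allI impI)
    fix i assume "d < i"
    then show "coeff q i = 0"
      by (cases "i = degree p") (auto simp: q_def d intro: coeff_eq_0)
  qed
  show ?thesis
  proof
    show "C \<ge> 1"
      using \<open>a > 0\<close> \<open>S \<ge> 0\<close> by (simp add: C_def)
    fix w :: 'a
    define y where "y = max 1 (norm w)"
    define M where "M = max 1 (norm (poly p w))"
    have "y \<ge> 1" "M \<ge> 1"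
      by (auto simp: y_def M_def)
    have C_le: "B \<le> C * M" if "B \<le> 1 \<or> B \<le> (2 * S / a) ^ degree p \<or> B \<le> 2 / a * M" for B
    proof -
      have "0 \<le> (2 * S / a) ^ degree p"
        using \<open>a > 0\<close> \<open>S \<ge> 0\<close> by simp
      from mult_left_mono[OF \<open>M \<ge> 1\<close> this]
      have "1 \<le> 1 * M" "(2 * S / a) ^ degree p \<le> (2 * S / a) ^ degree p * M"
        using \<open>M \<ge> 1\<close> by simp_all
      moreover have "0 \<le> (2 * S / a) ^ degree p * M" "0 \<le> 2 / a * M"
        using \<open>M \<ge> 1\<close> \<open>a > 0\<close> \<open>S \<ge> 0\<close> by auto
      moreover have "C * M = 1 * M + (2 * S / a) ^ degree p * M + 2 / a * M"
        by (simp add: C_def algebra_simps)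
      ultimately show ?thesis
        using that by linarith
    qed
    consider "norm w \<le> 1" | "norm w > 1" "a * y \<le> 2 * S" | "norm w > 1" "a * y > 2 * S"
      by linarith
    then have "y ^ degree p \<le> C * M"
    proof cases
      case 1
      then show ?thesis
        by (intro C_le) (simp add: y_def)
    next
      case 2
      then have "y \<le> 2 * S / a"
        using \<open>a > 0\<close> by (simp add: field_simps)
      then show ?thesis
        using \<open>y \<ge> 1\<close> by (intro C_le) (auto intro: power_mono)
    next
      case 3
      have "poly p w = poly q w + lead_coeff p * w ^ degree p"
        by (simp add: q_def poly_monom)
      then have "norm (lead_coeff p * w ^ degree p) \<le> norm (poly p w) + norm (poly q w)"
        by (metis add_diff_cancel_left' norm_triangle_ineq4)
      moreover have "norm (lead_coeff p * w ^ degree p) = a * y ^ degree p"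
        using 3 by (simp add: a_def y_def norm_mult norm_power)
      moreover have "norm (poly q w) \<le> S * y ^ d"
        unfolding S_def y_def by (rule norm_poly_le_max_power) fact
      ultimately have "a * y ^ degree p \<le> M + S * y ^ d"
        by (simp add: M_def)
      moreover have "2 * (S * y ^ d) \<le> a * y ^ degree p"
        using 3 \<open>y \<ge> 1\<close> mult_right_mono[of "2 * S" "a * y" "y ^ d"] by (simp add: d mult_ac)
      ultimately have "y ^ degree p \<le> 2 / a * M"
        using \<open>a > 0\<close> by (simp add: field_simps)
      then show ?thesis
        by (intro C_le) auto
    qed
    then show "max 1 (norm w) ^ degree p \<le> C * max 1 (norm (poly p w))"
      by (simp add: y_def M_def)
  qed
qed

text \<open>\<open>Q \<circ> P\<^sup>-\<^sup>1\<close> is \<open>O(|z|\<^bsup>m/n\<^esup>)\<close> at infinity; the parameter \<open>t\<close> plays the role of \<open>|z|\<^bsup>1/n\<^esup>\<close>.\<close>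

lemma norm_poly_on_fiber_le:
  fixes P Q :: "'a::real_normed_field poly"
  assumes "degree P > 0"
  obtains K where "K \<ge> 0"
    "\<And>w t. t \<ge> 1 \<Longrightarrow> norm (poly P w) \<le> t ^ degree P \<Longrightarrow> norm (poly Q w) \<le> K * t ^ degree Q"
proof -
  obtain C where C: "C \<ge> 1" "\<And>w. max 1 (norm w) ^ degree P \<le> C * max 1 (norm (poly P w))"
    using max_power_le_norm_poly[OF assms] by blast
  define S where "S = (\<Sum>i\<le>degree Q. norm (coeff Q i))"
  have "S \<ge> 0"
    by (simp add: S_def sum_nonneg)
  show ?thesis
  proof
    show "S * C ^ degree Q \<ge> 0"
      using \<open>S \<ge> 0\<close> C by simp
    fix w and t :: real assume t: "t \<ge> 1" "norm (poly P w) \<le> t ^ degree P"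
    have "max 1 (norm w) ^ degree P \<le> C * max 1 (norm (poly P w))"
      by (rule C)
    also have "\<dots> \<le> C * t ^ degree P"
      using t C by (intro mult_left_mono) auto
    \<comment> \<open>Since \<open>C\<close> is at least 1, raising it to a power is harmless; both
      sides are then powers with exponent \<open>degree P\<close>, and the bases can be
      compared.\<close>
    also have "\<dots> \<le> C ^ degree P * t ^ degree P"
      using t C assms by (intro mult_right_mono) (auto simp: self_le_power)
    finally have "max 1 (norm w) ^ degree P \<le> (C * t) ^ degree P"
      by (simp add: power_mult_distrib)
    then have y: "max 1 (norm w) \<le> C * t"
      using assms C t by (subst (asm) power_mono_iff) auto
    have "norm (poly Q w) \<le> S * max 1 (norm w) ^ degree Q"
      unfolding S_def by (rule norm_poly_le_max_power) simp
    also have "\<dots> \<le> S * (C * t) ^ degree Q"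
      using y \<open>S \<ge> 0\<close> by (intro mult_left_mono power_mono) auto
    finally show "norm (poly Q w) \<le> S * C ^ degree Q * t ^ degree Q"
      by (simp add: power_mult_distrib mult_ac)
  qed
qed

section \<open>Holomorphic functions\<close>

text \<open>The growth bound makes \<open>F\<close> bounded near each point of \<open>X\<close>, so
  its singularities are removable. By Liouville the extension is a polynomial of degree at most
  \<open>D\<close>, and its \<open>D\<close> + 1 Taylor coefficients at \<open>a\<close>
  vanish.\<close>

lemma holomorphic_polynomial_growth_eq_0:
  assumes X: "finite X" and hol: "F holomorphic_on - X"
    and le: "\<And>z. z \<notin> X \<Longrightarrow> norm (F z) \<le> C * max 1 (norm z) ^ D"
    and U: "open U" "U \<inter> X = {}" "a \<in> U"
    and der: "\<And>k. k \<le> D \<Longrightarrow> (deriv ^^ k) F a = 0"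
    and z: "z \<notin> X"
  shows "F z = 0"
proof -
  have "C \<ge> 0"
    using le[of a] U norm_ge_zero[of "F a"]
    by (smt (verit, best) disjoint_iff mult_neg_pos zero_less_power)
  have "F \<in> O[at x](\<lambda>_. 1)" for x
  proof (rule bigoI)
    have "eventually (\<lambda>y. y \<in> (ball x 1 - (X - {x})) - {x}) (at x)"
      using X by (intro eventually_at_in_open open_Diff finite_imp_closed) auto
    then show "eventually (\<lambda>y. norm (F y) \<le> C * (2 + norm x) ^ D * norm (1::complex)) (at x)"
    proof eventually_elim
      case (elim y)
      have "norm y \<le> norm x + 1"
        using elim norm_triangle_ineq2[of y x] by (simp add: dist_norm norm_minus_commute)
      then have "C * max 1 (norm y) ^ D \<le> C * (2 + norm x) ^ D"
        using \<open>C \<ge> 0\<close> by (intro mult_left_mono power_mono) auto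
      then show ?case
        using le[of y] elim by auto
    qed
  qed
  then obtain G where G: "G holomorphic_on UNIV" "\<And>z. z \<notin> X \<Longrightarrow> G z = F z"
    using removable_singularities[of X UNIV F] X hol by (auto simp: Compl_eq_Diff_UNIV)
  obtain A where A: "\<And>x. x \<in> X \<Longrightarrow> norm x < A" "A \<ge> 1"
    using finite_imp_bounded[OF X] unfolding bounded_pos_less
    by (metis max.strict_coboundedI2 max.cobounded1 less_max_iff_disj)
  \<comment> \<open>\<open>Liouville_polynomial\<close> expands about 0, so \<open>a\<close> is
    moved there.\<close>
  define H where "H = (\<lambda>x::complex. a + x)"
  have "(deriv ^^ k) (G \<circ> H) 0 = 0" if "k \<le> D" for k
  proof -
    have "(deriv ^^ k) (G \<circ> H) 0 = (deriv ^^ k) G a"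
      unfolding H_def by (rule higher_deriv_shift_0[symmetric])
    also have "\<dots> = (deriv ^^ k) F a"
      using U G hol
      by (intro higher_deriv_transform_within_open[of _ U])
        (auto intro: holomorphic_on_subset)
    finally show ?thesis
      using der that by simp
  qed
  moreover have "(G \<circ> H) \<xi> = (\<Sum>k\<le>D. (deriv ^^ k) (G \<circ> H) 0 / fact k * \<xi> ^ k)" for \<xi>
  proof (rule Liouville_polynomial)
    show "G \<circ> H holomorphic_on UNIV"
      unfolding H_def by (intro holomorphic_on_compose_gen[OF _ G(1)] holomorphic_intros) auto
    \<comment> \<open>This threshold puts \<open>a + x\<close> outside \<open>X\<close> at norm at
      least 1, and gives \<open>norm a \<le> norm x\<close>, whence
      \<open>norm (a + x) \<le> 2 * norm x\<close>.\<close>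
    fix x :: complex assume x: "A + norm a \<le> norm x"
    have *: "norm (a + x) \<ge> A"
      using x norm_diff_ineq[of x a] by (simp add: add.commute)
    then have "a + x \<notin> X"
      using A by force
    have "norm (F (a + x)) \<le> C * norm (a + x) ^ D"
      using le[OF \<open>a + x \<notin> X\<close>] * A(2) by (simp add: max_def split: if_splits)
    also have "\<dots> \<le> C * (2 * norm x) ^ D"
      using x A(2) \<open>C \<ge> 0\<close> norm_triangle_ineq[of a x] by (intro mult_left_mono power_mono) auto
    finally show "norm ((G \<circ> H) x) \<le> (C * 2 ^ D) * norm x ^ D"
      using G(2)[OF \<open>a + x \<notin> X\<close>] by (simp add: H_def power_mult_distrib mult_ac)
  qed
  ultimately have "(G \<circ> H) (z - a) = 0"
    by simp
  then show ?thesis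
    using G(2)[OF z] by (simp add: H_def)
qed

text \<open>Holomorphic functions on a domain have no zero divisors: where one factor is nonzero the
  others have product 0, and this spreads from a nonempty open set to all of
  \<open>U\<close>.\<close>

lemma holomorphic_prod_eq_0:
  assumes U: "open U" "connected U" and "finite A"
    and "\<And>x. x \<in> A \<Longrightarrow> c x holomorphic_on U"
    and "\<And>z. z \<in> U \<Longrightarrow> (\<Prod>x\<in>A. c x z) = 0" and "U \<noteq> {}"
  shows "\<exists>x\<in>A. \<forall>z\<in>U. c x z = 0"
  using assms(3-5)
proof (induction A rule: finite_induct)
  case empty
  then show ?case
    using \<open>U \<noteq> {}\<close> by auto
next
  case (insert x A)
  show ?case
  proof (cases "\<forall>z\<in>U. c x z = 0")
    case False
    define V where "V = U \<inter> c x -` (- {0})"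
    have "open V"
      unfolding V_def using U insert.prems
      by (intro continuous_open_preimage holomorphic_on_imp_continuous_on) auto
    moreover have "V \<noteq> {}" "V \<subseteq> U"
      using False by (auto simp: V_def)
    moreover have "(\<Prod>y\<in>A. c y z) = 0" if "z \<in> V" for z
      using insert.prems(2)[of z] insert.hyps that by (auto simp: V_def)
    moreover have "(\<lambda>z. \<Prod>y\<in>A. c y z) holomorphic_on U"
      using insert.prems by (intro holomorphic_on_prod) auto
    ultimately have "(\<Prod>y\<in>A. c y z) = 0" if "z \<in> U" for z
      using analytic_continuation_open[of V U "\<lambda>z. \<Prod>y\<in>A. c y z" "\<lambda>_. 0" z] U that
      by auto
    then show ?thesis
      using insert by auto
  qed auto
qed

section \<open>The symmetric functions of the conjugates\<close>

text \<open>At critical values the fiber has fewer than \<open>degree P\<close> points, and the value is junk.\<close>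

definition fiber_enum :: "complex poly \<Rightarrow> complex \<Rightarrow> nat \<Rightarrow> complex" where
  "fiber_enum P z = (SOME v. bij_betw v {1..degree P} {w. poly P w = z})"

text \<open>Numbering each fiber afresh gives a function on the whole plane without continuing
  branches along paths; off the critical values the choice does not affect it.\<close>

definition resolvent_coeff ::
    "complex poly \<Rightarrow> complex poly \<Rightarrow> (nat \<Rightarrow> complex) \<Rightarrow> nat \<Rightarrow> complex \<Rightarrow> complex" where
  "resolvent_coeff P Q f k z = coeff (resolvent Q (degree P) f (fiber_enum P z)) k"

lemma resolvent_coeff_eq:
  assumes "bij_betw v {1..degree P} {w. poly P w = z}"
  shows "resolvent_coeff P Q f k z = coeff (resolvent Q (degree P) f v) k"
proof -
  have "bij_betw (fiber_enum P z) {1..degree P} {w. poly P w = z}"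
    unfolding fiber_enum_def by (rule someI_ex[of "\<lambda>v. bij_betw v _ _"]) (use assms in blast)
  then show ?thesis
    unfolding resolvent_coeff_def using resolvent_cong[OF assms] by metis
qed

lemma permuted_sum_holomorphic:
  assumes "inverse_branches P U g" and "\<sigma> permutes {1..degree P}"
  shows "(\<lambda>z. permuted_sum Q (degree P) f (\<lambda>i. g i z) \<sigma>) holomorphic_on U"
  unfolding permuted_sum_def
proof (intro holomorphic_on_sum holomorphic_on_mult holomorphic_on_const poly_holomorphic_on)
  fix i assume "i \<in> {1..degree P}"
  then have "\<sigma> i \<in> {1..degree P}"
    using permutes_in_image[OF assms(2)] by blast
  then show "g (\<sigma> i) holomorphic_on U"
    using assms(1) by (simp add: inverse_branches_def inverse_branch_def)
qed

text \<open>Holomorphy is local, and near a noncritical value the fibers can be numbered by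
  holomorphic branches.\<close>

lemma resolvent_coeff_holomorphic:
  "resolvent_coeff P Q f k holomorphic_on - critical_values P"
proof -
  have nbhd: "\<exists>S. open S \<and> z \<in> S \<and> resolvent_coeff P Q f k holomorphic_on S"
    if z: "z \<notin> critical_values P" for z
  proof -
    obtain r h where rh: "r > 0" "ball z r \<inter> critical_values P = {}"
        "inverse_branches P (ball z r) h"
      using local_inverse_branches[OF z] by blast
    have "(\<lambda>y. coeff (resolvent Q (degree P) f (\<lambda>i. h i y)) k) holomorphic_on ball z r"
      unfolding resolvent_def
      by (rule coeff_prod_linear_holomorphic)
        (use rh(3) in \<open>auto intro: permuted_sum_holomorphic finite_permutations\<close>)
    then have "resolvent_coeff P Q f k holomorphic_on ball z r"
      by (rule holomorphic_transform)
        (use rh in \<open>auto intro!: resolvent_coeff_eq[symmetric] inverse_branches_bij_betw[of "ball z r"]\<close>)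
    then show ?thesis
      using rh(1) by (intro exI[of _ "ball z r"]) auto
  qed
  then have "resolvent_coeff P Q f k analytic_on - critical_values P"
    by (subst analytic_on_analytic_at) (auto simp: analytic_at)
  then show ?thesis
    by (rule analytic_imp_holomorphic)
qed

text \<open>With t the n-th root of \<open>max 1 (norm z)\<close>, each of the n! conjugates is
  O(t^m), so every coefficient is O(t^(m n!)).\<close>

lemma resolvent_coeff_growth:
  assumes "degree P > 0"
  obtains C where "\<And>k z. z \<notin> critical_values P \<Longrightarrow>
    norm (resolvent_coeff P Q f k z) \<le> C * max 1 (norm z) ^ (degree Q * fact (degree P - 1))"
proof -
  let ?n = "degree P" and ?m = "degree Q"
  obtain K where K: "K \<ge> 0"
    "\<And>w t. t \<ge> 1 \<Longrightarrow> norm (poly P w) \<le> t ^ ?n \<Longrightarrow> norm (poly Q w) \<le> K * t ^ ?m"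
    using norm_poly_on_fiber_le[OF assms, of Q] by blast
  define B where "B = (\<Sum>i=1..?n. norm (f i)) * K"
  have "B \<ge> 0"
    using K by (simp add: B_def sum_nonneg)
  show ?thesis
  proof
    fix k z assume z: "z \<notin> critical_values P"
    obtain r h where rh: "r > 0" "ball z r \<inter> critical_values P = {}"
        "inverse_branches P (ball z r) h"
      using local_inverse_branches[OF z] by blast
    define v where "v = (\<lambda>i. h i z)"
    have v: "bij_betw v {1..?n} {w. poly P w = z}"
      unfolding v_def using rh by (intro inverse_branches_bij_betw[of "ball z r"]) auto
    define t where "t = root ?n (max 1 (norm z))"
    have tn: "t ^ ?n = max 1 (norm z)"
      unfolding t_def using assms by (simp add: real_root_pow_pos2)
    have "t \<ge> 1"
      unfolding t_def using assms by simp
    have "norm (permuted_sum Q ?n f v \<sigma>) \<le> B * t ^ ?m" if "\<sigma> permutes {1..?n}" for \<sigma>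
    proof -
      have "norm (permuted_sum Q ?n f v \<sigma>) \<le> (\<Sum>i=1..?n. norm (f i) * (K * t ^ ?m))"
        unfolding permuted_sum_def
      proof (intro sum_norm_le)
        fix i assume "i \<in> {1..?n}"
        then have "\<sigma> i \<in> {1..?n}"
          using permutes_in_image[OF that] by blast
        then have "poly P (v (\<sigma> i)) = z"
          using v by (auto simp: bij_betw_def)
        then have "norm (poly Q (v (\<sigma> i))) \<le> K * t ^ ?m"
          using \<open>t \<ge> 1\<close> tn by (intro K) auto
        then show "norm (f i * poly Q (v (\<sigma> i))) \<le> norm (f i) * (K * t ^ ?m)"
          by (simp add: norm_mult mult_left_mono)
      qed
      then show ?thesis
        by (simp add: B_def mult.assoc flip: sum_distrib_right)
    qed
    then have "norm (coeff (resolvent Q ?n f v) k)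
        \<le> (1 + B * t ^ ?m) ^ card {\<sigma>. \<sigma> permutes {1..?n}}"
      unfolding resolvent_def using \<open>B \<ge> 0\<close> \<open>t \<ge> 1\<close>
      by (intro norm_coeff_prod_linear_le) (auto intro: finite_permutations)
    also have "card {\<sigma>. \<sigma> permutes {1..?n}} = fact ?n"
      by (intro card_permutations) auto
    also have "(1 + B * t ^ ?m) ^ fact ?n \<le> ((1 + B) * t ^ ?m) ^ fact ?n"
      using \<open>B \<ge> 0\<close> \<open>t \<ge> 1\<close> by (intro power_mono) (auto simp: algebra_simps)
    \<comment> \<open>Splitting n! as n (n - 1)! turns the power of t into one of t^n, and the root
      disappears.\<close>
    also have "\<dots> = (1 + B) ^ fact ?n * (t ^ ?n) ^ (?m * fact (?n - 1))"
      using assms by (simp add: power_mult_distrib fact_reduce mult_ac flip: power_mult)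
    finally show "norm (resolvent_coeff P Q f k z)
        \<le> (1 + B) ^ fact ?n * max 1 (norm z) ^ (?m * fact (?n - 1))"
      using resolvent_coeff_eq[OF v, of Q f k] tn by simp
  qed
qed

section \<open>Vanishing of \<psi> deduced from its order at \<open>z0\<close>\<close>

theorem corollary2p1:
  fixes P Q :: "complex poly" and n m :: nat and U :: "complex set"
    and g :: "nat \<Rightarrow> complex \<Rightarrow> complex" and f :: "nat \<Rightarrow> complex"
    and \<psi> :: "complex \<Rightarrow> complex" and z0 :: complex
  assumes "degree P = n" and "degree Q = m"
    and "open U" and "simply_connected U"
    and "U \<inter> critical_values P = {}"
    and "inverse_branches P U g"
    and "\<forall>z\<in>U. \<psi> z = (\<Sum>i=1..n. f i * poly Q (g i z))"
    and "z0 \<in> U"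
    and "\<forall>k. real k < real m / real n * fact n + 1 \<longrightarrow> fps_nth (fps_expansion \<psi> z0) k = 0"
  shows "\<forall>z\<in>U. \<psi> z = 0"
proof (cases "n = 0")
  \<comment> \<open>The sum is empty here; writing (m/n) n! as m (n - 1)! requires n > 0.\<close>
  case True
  then show ?thesis
    using assms(7) by simp
next
  case False
  have conn: "connected U"
    using assms(4) by (rule simply_connected_imp_connected)
  define D where "D = m * fact (n - 1)"
  have D: "real m / real n * fact n = real D"
    using False by (simp add: D_def fact_reduce)
  \<comment> \<open>The strict bound \<open>real k < D + 1\<close> covers k = 0, ...,
    \<open>D\<close>, one coefficient more than a polynomial of degree \<open>D\<close> can have
    vanish without being 0.\<close>
  have \<psi>_der: "(deriv ^^ k) \<psi> z0 = 0" if "k \<le> D" for k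
    using assms(9) that unfolding D by (auto simp: fps_expansion_def)
  define A where "A = {\<sigma>. \<sigma> permutes {1..n}}"
  have "finite A"
    by (simp add: A_def finite_permutations)
  define c where "c = (\<lambda>\<sigma> z. permuted_sum Q n f (\<lambda>i. g i z) \<sigma>)"
  have c_hol: "c \<sigma> holomorphic_on U" if "\<sigma> \<in> A" for \<sigma>
    using permuted_sum_holomorphic[OF assms(6)] that assms(1) by (simp add: c_def A_def)
  have c_id: "c id z = \<psi> z" if "z \<in> U" for z
    using assms(7) that by (simp add: c_def permuted_sum_def)
  define Z where "Z = {\<sigma>\<in>A. \<forall>z\<in>U. c \<sigma> z = 0}"
  show ?thesis
  proof (rule ccontr)
    assume "\<not> ?thesis"
    then have id: "id \<in> A - Z"
      using c_id by (auto simp: Z_def A_def permutes_id)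
    \<comment> \<open>The outer minus absorbs the sign of the factor at \<open>id\<close>, so that
      the product over \<open>A - Z\<close> is \<open>\<psi> z * R z\<close>.\<close>
    define R where "R = (\<lambda>z. - (\<Prod>\<sigma>\<in>A - Z - {id}. - c \<sigma> z))"
    have R_hol: "R holomorphic_on U"
      unfolding R_def using c_hol by (intro holomorphic_intros) auto
    have \<psi>_hol: "\<psi> holomorphic_on U"
      using c_hol[of id] id c_id by (auto intro: holomorphic_transform)
    \<comment> \<open>On \<open>U\<close> this is the product of the conjugates that are not
      identically zero; being holomorphic off all critical values, it is also open to
      Liouville.\<close>
    define E where "E = resolvent_coeff P Q f (card Z)"
    have E: "E z = (\<Prod>\<sigma>\<in>A - Z. - c \<sigma> z)" if "z \<in> U" for z
    proof -
      have "E z = coeff (resolvent Q (degree P) f (\<lambda>i. g i z)) (card Z)"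
        unfolding E_def using assms(3,5,6) that conn
        by (intro resolvent_coeff_eq inverse_branches_bij_betw[of U])
      also have "\<dots> = coeff (\<Prod>\<sigma>\<in>A. [:- c \<sigma> z, 1:]) (card Z)"
        by (simp add: resolvent_def A_def c_def assms(1))
      also have "\<dots> = (\<Prod>\<sigma>\<in>A - Z. - c \<sigma> z)"
        using \<open>finite A\<close> that by (intro coeff_prod_linear_card_zeros) (auto simp: Z_def)
      finally show ?thesis .
    qed
    have E_\<psi>: "E z = \<psi> z * R z" if "z \<in> U" for z
      unfolding E[OF that] R_def using id \<open>finite A\<close> c_id[OF that]
      by (subst prod.remove[of _ id]) auto
    have E_hol: "E holomorphic_on - critical_values P"
      unfolding E_def by (rule resolvent_coeff_holomorphic)
    have E_der: "(deriv ^^ k) E z0 = 0" if "k \<le> D" for k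
    proof -
      have "(deriv ^^ k) E z0 = (deriv ^^ k) (\<lambda>z. \<psi> z * R z) z0"
        using assms(3,5,8) E_\<psi> R_hol \<psi>_hol
        by (intro higher_deriv_transform_within_open[of _ U] holomorphic_intros
            holomorphic_on_subset[OF E_hol]) auto
      \<comment> \<open>In Leibniz's formula every term contains a derivative of
        \<open>\<psi>\<close> of order at most k, hence at most \<open>D\<close>.\<close>
      also have "\<dots> = (\<Sum>i = 0..k. of_nat (k choose i) * (deriv ^^ i) \<psi> z0 * (deriv ^^ (k - i)) R z0)"
        using assms(3,8) R_hol \<psi>_hol by (intro higher_deriv_mult[of _ U])
      also have "\<dots> = 0"
        using that by (intro sum.neutral) (auto simp: \<psi>_der)
      finally show ?thesis .
    qed
    have "degree P > 0"
      using False assms(1) by simp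
    then obtain C where "\<And>z. z \<notin> critical_values P \<Longrightarrow> norm (E z) \<le> C * max 1 (norm z) ^ D"
      using resolvent_coeff_growth[of P Q f thesis] unfolding E_def D_def assms(1,2) by metis
    then have "E z = 0" if "z \<in> U" for z
      using assms(3,5,8) E_der that
      by (intro holomorphic_polynomial_growth_eq_0[OF finite_critical_values E_hol, of C D U z0]) auto
    \<comment> \<open>Some conjugate outside \<open>Z\<close> would vanish on \<open>U\<close>,
      against the choice of \<open>Z\<close>.\<close>
    then have "\<exists>\<sigma>\<in>A - Z. \<forall>z\<in>U. - c \<sigma> z = 0"
      using assms(3,8) conn \<open>finite A\<close> c_hol E
      by (intro holomorphic_prod_eq_0) (auto intro!: holomorphic_intros)
    then show False
      by (auto simp: Z_def)
  qed
qed

end
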